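(* Let $s\ge0$ be an integer, $h\in\mathbb C\setminus\{0\}$, $q\in\mathbb C\setminus\{0\}$, and let $U,V$ satisfy $UV-qVU=hV^s$. Let $n\ge1$, let $\mathbf r=(r_1,\ldots,r_n)$ and $\mathbf s=(s_1,\ldots,s_n)$ be sequences of nonnegative integers, and let $H_{\mathbf r,\mathbf s}=V^{r_n}U^{s_n}\cdots V^{r_2}U^{s_2}V^{r_1}U^{s_1}$. Then $$H_{\mathbf r,\mathbf s}=\sum_{j_1=0}^{s_2}\sum_{j_2=0}^{s_3}\cdots\sum_{j_{n-1}=0}^{s_n}h^{j_1+\cdots+j_{n-1}}\left(\prod_{i=1}^{n-1}\Gamma_{q,s}\bigl[j_i,\;r_1+\cdots+r_i+(j_1+\cdots+j_{i-1})(s-1),\;s_{i+1}\bigr]\right)V^{r_1+\cdots+r_n+(j_1+\cdots+j_{n-1})(s-1)}U^{s_1+\cdots+s_n-(j_1+\cdots+j_{n-1})},$$ where $$\Gamma_{q,s}[j,r',s']=q^{r'(s'-j)}\genfrac{[}{]}{0pt}{}{s'}{j}_{q^{s-1}}\prod_{i=0}^{j-1}[r'+i(s-1)]_q .$$ (Terms in which the exponent of $V$ is negative have coefficient $0$ and are read as $0$.) Hence, for $s_1\le k\le|\mathbf s|$, $$S^{\mathbf r,\mathbf s}_{s,h,q}[k]=h^{|\mathbf s|-k}\sum_{j_1+\cdots+j_{n-1}=s_1+\cdots+s_n-k}\ \prod_{i=1}^{n-1}\Gamma_{q,s}\bigl[j_i,\;r_1+\cdots+r_i+(j_1+\cdots+j_{i-1})(s-1),\;s_{i+1}\bigr],$$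 the sum being over nonnegative integers $j_1,\ldots,j_{n-1}$.
   Context: For an integer $x$, $[x]_q=\frac{q^x-1}{q-1}$ if $q\ne1$ and $[x]_1=x$. $\genfrac{[}{]}{0pt}{}{n}{k}_p$ is the Gaussian ($p$-binomial) coefficient, understood as a polynomial in $p$ evaluated at the given value, and equal to $0$ if $k>n$. For a finite sequence, $|\cdot|$ denotes the sum of its entries. The numbers $S^{\mathbf r,\mathbf s}_{s,h,q}[k]$ are the normal ordering coefficients of $H_{\mathbf r,\mathbf s}$, i.e. in the algebra $\mathbb C\langle U,V\rangle/(UV-qVU-hV^s)$ (in which the monomials $V^iU^j$, $i,j\ge0$, form a basis) they are defined by $H_{\mathbf r,\mathbf s}=\sum_{k=s_1}^{|\mathbf s|}S^{\mathbf r,\mathbf s}_{s,h,q}[k]\,V^{|\mathbf r|-(|\mathbf s|-k)(1-s)}U^k$, with the coefficient taken to be $0$ when the exponent of $V$ is negative. Empty sums in arguments equal $0$, empty products equal $1$. *)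

theory Defs
  imports
    "HOL-Library.Poly_Mapping"
    "HOL-Library.FuncSet"
    "HOL-Computational_Algebra.Polynomial"
    Complex_Main
begin

definition qint :: "complex \<Rightarrow> int \<Rightarrow> complex" where
  "qint q x = (if q = 1 then of_int x else (q powi x - 1) / (q - 1))"

text \<open>
  For \<open>k > n\<close> the numerator contains the factor with \<open>i = n\<close>, which vanishes.
  The polynomial division is exact, see \<open>gauss_poly_exact\<close> below.
\<close>

definition gauss_num :: "nat \<Rightarrow> nat \<Rightarrow> complex poly" where
  "gauss_num n k = (\<Prod>i<k. monom 1 (n - i) - 1)"

definition gauss_den :: "nat \<Rightarrow> complex poly" where
  "gauss_den k = (\<Prod>i<k. monom 1 (Suc i) - 1)"

definition gauss_poly :: "nat \<Rightarrow> nat \<Rightarrow> complex poly" where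
  "gauss_poly n k = gauss_num n k div gauss_den k"

definition gauss_coeff :: "complex \<Rightarrow> nat \<Rightarrow> nat \<Rightarrow> complex" where
  "gauss_coeff p n k = poly (gauss_poly n k) p"

lemma gauss_num_gt: "k > n \<Longrightarrow> gauss_num n k = 0"
  unfolding gauss_num_def by (rule prod_zero) (auto intro!: bexI[of _ n])

lemma gauss_den_dvd_num: "gauss_den k dvd gauss_num n k"
proof (induction n arbitrary: k)
  case 0
  show ?case by (cases k) (simp_all add: gauss_den_def gauss_num_gt)
next
  case (Suc n)
  show ?case
  proof (cases k)
    case 0
    then show ?thesis by (simp add: gauss_den_def)
  next
    case (Suc m)
    have num: "gauss_num (Suc n) (Suc m) = (monom 1 (Suc n) - 1) * gauss_num n m"
      by (simp add: gauss_num_def prod.lessThan_Suc_shift del: prod.lessThan_Suc)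
    have num': "gauss_num n (Suc m) = gauss_num n m * (monom 1 (n - m) - 1)"
      by (simp add: gauss_num_def)
    have den: "gauss_den (Suc m) = gauss_den m * (monom 1 (Suc m) - 1)"
      by (simp add: gauss_den_def)
    have eq: "gauss_num (Suc n) (Suc m) =
        monom 1 (Suc m) * gauss_num n (Suc m) + gauss_num n m * (monom 1 (Suc m) - 1)"
    proof (cases "m \<le> n")
      case True
      then have "monom 1 (Suc n) = (monom 1 (Suc m) * monom 1 (n - m) :: complex poly)"
        by (simp add: mult_monom)
      then show ?thesis unfolding num num' by (simp add: algebra_simps)
    next
      case False
      then have "gauss_num n m = 0" by (simp add: gauss_num_gt)
      then show ?thesis unfolding num num' by simp
    qed
    have "gauss_den (Suc m) dvd gauss_num n m * (monom 1 (Suc m) - 1)"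
      unfolding den by (intro mult_dvd_mono Suc.IH dvd_refl)
    from dvd_add[OF dvd_mult[OF Suc.IH[of "Suc m"]] this] show ?thesis
      unfolding \<open>k = Suc m\<close> eq .
  qed
qed

lemma gauss_poly_exact: "gauss_poly n k * gauss_den k = gauss_num n k"
  unfolding gauss_poly_def by (rule dvd_div_mult_self[OF gauss_den_dvd_num])

lemma gauss_poly_gt: "k > n \<Longrightarrow> gauss_poly n k = 0"
  by (simp add: gauss_poly_def gauss_num_gt)

definition Gamma_qs :: "complex \<Rightarrow> nat \<Rightarrow> nat \<Rightarrow> int \<Rightarrow> nat \<Rightarrow> complex" where
  "Gamma_qs q s j r' s' =
     q powi (r' * (int s' - int j)) * gauss_coeff (q powi (int s - 1)) s' j *
     (\<Prod>i<j. qint q (r' + int i * (int s - 1)))"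

text \<open>Unital associative complex algebras; \<open>scale\<close> is the scalar multiplication.\<close>

locale complex_algebra = vector_space scale
  for scale :: "complex \<Rightarrow> 'a::ring_1 \<Rightarrow> 'a" +
  assumes scale_mult_left: "scale c x * y = scale c (x * y)"
    and scale_mult_right: "x * scale c y = scale c (x * y)"

text \<open>
  Sequences are functions on \<open>nat\<close> of which only the entries with indices \<open>1,\<dots>,n\<close> are used;
  the sequences \<open>r\<close> and \<open>t\<close> hold the exponents of \<open>V\<close> and of \<open>U\<close>, respectively.
\<close>

definition seq_sum :: "nat \<Rightarrow> (nat \<Rightarrow> nat) \<Rightarrow> nat" where
  "seq_sum m a = (\<Sum>i=1..m. a i)"

definition H_word :: "'a::monoid_mult \<Rightarrow> 'a \<Rightarrow> nat \<Rightarrow> (nat \<Rightarrow> nat) \<Rightarrow> (nat \<Rightarrow> nat) \<Rightarrow> 'a" where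
  "H_word U V n r t = prod_list (map (\<lambda>i. V ^ r i * U ^ t i) (rev [1..<Suc n]))"

text \<open>\<open>V\<^sup>e U\<^sup>k\<close>, read as \<open>0\<close> when the exponent of \<open>V\<close> is negative.\<close>

definition VU_monomial :: "'a::ring_1 \<Rightarrow> 'a \<Rightarrow> int \<Rightarrow> nat \<Rightarrow> 'a" where
  "VU_monomial U V e k = (if e < 0 then 0 else V ^ nat e * U ^ k)"

definition Gamma_prod ::
  "complex \<Rightarrow> nat \<Rightarrow> nat \<Rightarrow> (nat \<Rightarrow> nat) \<Rightarrow> (nat \<Rightarrow> nat) \<Rightarrow> (nat \<Rightarrow> nat) \<Rightarrow> complex" where
  "Gamma_prod q s n r t j =
     (\<Prod>i=1..n-1. Gamma_qs q s (j i)
        (int (seq_sum i r) + int (seq_sum (i - 1) j) * (int s - 1)) (t (i + 1)))"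

definition V_exponent :: "nat \<Rightarrow> nat \<Rightarrow> (nat \<Rightarrow> nat) \<Rightarrow> (nat \<Rightarrow> nat) \<Rightarrow> int" where
  "V_exponent s n r j = int (seq_sum n r) + int (seq_sum (n - 1) j) * (int s - 1)"

text \<open>
  The free algebra on two generators is the monoid algebra of the free monoid of words, where
  addition of words is concatenation (\<open>poly_mapping\<close> expects an additive exponent monoid).
\<close>

datatype letter = U_letter | V_letter

datatype word = Word (letters: "letter list")

instantiation word :: monoid_add
begin

definition zero_word :: word where "0 = Word []"

definition plus_word :: "word \<Rightarrow> word \<Rightarrow> word" where
  "v + w = Word (letters v @ letters w)"

instance
  by standard (auto simp: zero_word_def plus_word_def)

end

type_synonym free_alg = "word \<Rightarrow>\<^sub>0 complex"

definition free_scale :: "complex \<Rightarrow> free_alg \<Rightarrow> free_alg" where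
  "free_scale c p = Poly_Mapping.single 0 c * p"

definition free_U :: free_alg where
  "free_U = Poly_Mapping.single (Word [U_letter]) 1"

definition free_V :: free_alg where
  "free_V = Poly_Mapping.single (Word [V_letter]) 1"

lemma single_0_commute:
  "Poly_Mapping.single 0 c * p = p * Poly_Mapping.single (0 :: word) (c :: complex)"
proof (induction p rule: update_induct)
  case const
  show ?case by simp
next
  case (update f a b)
  have "Poly_Mapping.update a b f = Poly_Mapping.single a b + f"
    using update(1)
    by (intro poly_mapping_eqI) (auto simp: lookup_update lookup_add lookup_single in_keys_iff when_def)
  then show ?case
    using update(3) by (simp add: distrib_left distrib_right mult_single mult.commute)
qed

lemma complex_algebra_free: "complex_algebra free_scale"
proof
  fix a b :: complex and x y :: free_alg
  show "free_scale a (x + y) = free_scale a x + free_scale a y"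
    by (simp add: free_scale_def distrib_left)
  show "free_scale (a + b) x = free_scale a x + free_scale b x"
    by (simp add: free_scale_def single_add distrib_right)
  show "free_scale a (free_scale b x) = free_scale (a * b) x"
    by (simp add: free_scale_def mult_single flip: mult.assoc)
  show "free_scale 1 x = x"
    by (simp add: free_scale_def)
  show "free_scale a x * y = free_scale a (x * y)"
    by (simp add: free_scale_def mult.assoc)
  show "x * free_scale a y = free_scale a (x * y)"
    unfolding free_scale_def by (simp only: single_0_commute mult.assoc)
qed

inductive_set two_sided_ideal :: "'a::ring_1 set \<Rightarrow> 'a set" for G where
  zero: "0 \<in> two_sided_ideal G"
| add: "x \<in> two_sided_ideal G \<Longrightarrow> g \<in> G \<Longrightarrow> x + a * g * b \<in> two_sided_ideal G"

text \<open>Equality in the quotient of the free algebra by the relation \<open>U V - q V U = h V\<^sup>s\<close>.\<close>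

definition quot_eq :: "nat \<Rightarrow> complex \<Rightarrow> complex \<Rightarrow> free_alg \<Rightarrow> free_alg \<Rightarrow> bool" where
  "quot_eq s h q x y \<longleftrightarrow>
     x - y \<in> two_sided_ideal
       {free_U * free_V - free_scale q (free_V * free_U) - free_scale h (free_V ^ s)}"

definition S_V_exponent ::
  "nat \<Rightarrow> nat \<Rightarrow> (nat \<Rightarrow> nat) \<Rightarrow> (nat \<Rightarrow> nat) \<Rightarrow> nat \<Rightarrow> int" where
  "S_V_exponent s n r t k =
     int (seq_sum n r) - (int (seq_sum n t) - int k) * (1 - int s)"

text \<open>
  The normal ordering coefficients of \<open>H_word\<close> in the quotient algebra. The two vanishing
  conditions only fix the values that do not occur in the expansion.
\<close>

definition S_coeff ::
  "nat \<Rightarrow> complex \<Rightarrow> complex \<Rightarrow> nat \<Rightarrow> (nat \<Rightarrow> nat) \<Rightarrow> (nat \<Rightarrow> nat) \<Rightarrow> nat \<Rightarrow> complex" where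
  "S_coeff s h q n r t = (THE c.
     (\<forall>k. k \<notin> {t 1..seq_sum n t} \<longrightarrow> c k = 0) \<and>
     (\<forall>k. S_V_exponent s n r t k < 0 \<longrightarrow> c k = 0) \<and>
     quot_eq s h q (H_word free_U free_V n r t)
       (\<Sum>k = t 1..seq_sum n t.
          free_scale (c k) (VU_monomial free_U free_V (S_V_exponent s n r t k) k)))"

end

theory Submission
  imports Defs
begin

text \<open>
  Iterating \<open>U V\<^sup>a = q\<^sup>a V\<^sup>a U + h [a]\<^sub>q V\<^bsup>a+s-1\<^esup>\<close>, the q-Pascal rule shows that \<open>\<Gamma>\<close> gives the
  normal ordering of \<open>U\<^sup>m V\<^sup>e\<close>; the formula for \<open>H\<close> follows by induction on the number of blocks.
  Working with congruences modulo a two-sided ideal covers an arbitrary algebra (zero ideal) and the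
  quotient of the free algebra at once. The coefficients are unique because the free algebra acts on
  formal combinations of the monomials \<open>V\<^sup>i U\<^sup>j\<close>, the relation acts as zero, and \<open>V\<^sup>i U\<^sup>j\<close> sends the
  basis vector \<open>1\<close> to the basis vector \<open>V\<^sup>i U\<^sup>j\<close>.
\<close>

section \<open>q-integers, Gaussian coefficients and the recurrence for
  \<open>Gamma_qs\<close>\<close>

lemma qint_0 [simp]: "qint q 0 = 0"
  by (simp add: qint_def)

lemma qint_plus_one:
  assumes "q \<noteq> 0"
  shows "qint q (x + 1) = qint q x + q powi x"
  using assms by (simp add: qint_def power_int_add divide_simps) (simp add: algebra_simps)

text \<open>Multiplied by \<open>gauss_den (Suc k)\<close>, this becomes an identity of numerators,
  and that nonzero polynomial can be cancelled. Cancelling before evaluation makes the rule valid at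
  every \<open>p\<close>, roots of unity included.\<close>

lemma gauss_poly_pascal:
  "gauss_poly (Suc n) (Suc k) = monom 1 (Suc k) * gauss_poly n (Suc k) + gauss_poly n k"
proof -
  have num: "gauss_num (Suc n) (Suc k) = (monom 1 (Suc n) - 1) * gauss_num n k"
    by (simp add: gauss_num_def prod.lessThan_Suc_shift del: prod.lessThan_Suc)
  have num': "gauss_num n (Suc k) = gauss_num n k * (monom 1 (n - k) - 1)"
    by (simp add: gauss_num_def)
  have den: "gauss_den (Suc k) = gauss_den k * (monom 1 (Suc k) - 1)"
    by (simp add: gauss_den_def)
  have eq: "gauss_num (Suc n) (Suc k) =
      monom 1 (Suc k) * gauss_num n (Suc k) + gauss_num n k * (monom 1 (Suc k) - 1)"
  proof (cases "k \<le> n")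
    case True
    then have "monom 1 (Suc n) = (monom 1 (Suc k) * monom 1 (n - k) :: complex poly)"
      by (simp add: mult_monom)
    then show ?thesis unfolding num num' by (simp add: algebra_simps)
  next
    case False
    then have "gauss_num n k = 0" by (simp add: gauss_num_gt)
    then show ?thesis unfolding num num' by simp
  qed
  have "monom 1 (Suc i) - 1 \<noteq> (0 :: complex poly)" for i
  proof
    assume "monom 1 (Suc i) - 1 = (0 :: complex poly)"
    \<comment> \<open>Evaluation at 0 gives -1, because the exponent \<open>Suc i\<close> is
      positive.\<close>
    then have "poly (monom 1 (Suc i) - 1 :: complex poly) 0 = poly 0 0" by (rule arg_cong)
    then show False by (simp add: poly_monom)
  qed
  then have nz: "gauss_den (Suc k) \<noteq> 0"
    by (simp add: gauss_den_def)
  have "gauss_poly (Suc n) (Suc k) * gauss_den (Suc k) =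
      monom 1 (Suc k) * (gauss_poly n (Suc k) * gauss_den (Suc k))
      + (gauss_poly n k * gauss_den k) * (monom 1 (Suc k) - 1)"
    unfolding gauss_poly_exact by (rule eq)
  also have "\<dots> = (monom 1 (Suc k) * gauss_poly n (Suc k) + gauss_poly n k) * gauss_den (Suc k)"
    by (simp add: den algebra_simps)
  finally show ?thesis using nz by simp
qed

lemma gauss_coeff_pascal:
  "gauss_coeff p (Suc n) (Suc k) = p ^ Suc k * gauss_coeff p n (Suc k) + gauss_coeff p n k"
  by (simp add: gauss_coeff_def gauss_poly_pascal poly_monom)

lemma gauss_coeff_0 [simp]: "gauss_coeff p n 0 = 1"
  by (simp add: gauss_coeff_def gauss_poly_def gauss_num_def gauss_den_def)

lemma Gamma_qs_gt: "j > m \<Longrightarrow> Gamma_qs q s j e m = 0"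
  by (simp add: Gamma_qs_def gauss_coeff_def gauss_poly_gt)

lemma Gamma_qs_0_0 [simp]: "Gamma_qs q s 0 e 0 = 1"
  by (simp add: Gamma_qs_def)

lemma Gamma_qs_0_Suc:
  assumes "q \<noteq> 0"
  shows "Gamma_qs q s 0 e (Suc m) = q powi e * Gamma_qs q s 0 e m"
  using assms by (simp add: Gamma_qs_def algebra_simps power_int_add)

text \<open>This is the effect of one more \<open>U\<close> on the left: it either passes the power
  of \<open>V\<close> with exponent \<open>e + (j+1)(s-1)\<close>, giving a power of
  \<open>q\<close>, or is absorbed by the one with exponent \<open>e + j(s-1)\<close>, giving a
  q-integer. Algebraically it is the q-Pascal rule at \<open>q powi (s-1)\<close>; the q-integer is
  the last factor of the product.\<close>

lemma Gamma_qs_Suc_Suc: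
  assumes "q \<noteq> 0"
  shows "Gamma_qs q s (Suc j) e (Suc m) =
    q powi (e + int (Suc j) * (int s - 1)) * Gamma_qs q s (Suc j) e m
    + qint q (e + int j * (int s - 1)) * Gamma_qs q s j e m"
proof -
  let ?A = "q powi (e * (int m - int j))" and ?B = "q powi (e * (int m - int (Suc j)))"
  let ?p = "q powi (int s - 1)"
  let ?P = "\<Prod>i<j. qint q (e + int i * (int s - 1))"
  have A: "?A = q powi e * ?B"
    using assms by (simp add: power_int_add [symmetric] algebra_simps)
  have "q powi (e + int (Suc j) * (int s - 1)) = q powi e * q powi (int (Suc j) * (int s - 1))"
    using assms by (intro power_int_add) simp
  also have "q powi (int (Suc j) * (int s - 1)) = ?p ^ Suc j"
    by (metis mult.commute power_int_mult power_int_of_nat)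
  finally have p: "q powi (e + int (Suc j) * (int s - 1)) = q powi e * ?p ^ Suc j" .
  show ?thesis
    unfolding Gamma_qs_def p gauss_coeff_pascal prod.lessThan_Suc
    using A by (simp add: algebra_simps)
qed

text \<open>If a walk of exponents steps from a nonnegative to a negative value, then \<open>s = 0\<close> and the
  factor \<open>[0]\<^sub>q\<close> occurs.\<close>

lemma Gamma_qs_eq_0:
  assumes "e \<ge> 0" "e + int j * (int s - 1) < 0"
  shows "Gamma_qs q s j e m = 0"
proof -
  have s: "s = 0"
  proof (rule ccontr)
    assume "s \<noteq> 0"
    then have "int j * (int s - 1) \<ge> 0" by simp
    with assms show False by simp
  qed
  \<comment> \<open>For \<open>s = 0\<close> the exponent drops by one per step, so it hits 0 at
    step \<open>e\<close>, before step \<open>j\<close>.\<close>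
  with assms have "nat e \<in> {..<j}" "qint q (e + int (nat e) * (int s - 1)) = 0"
    by auto
  then have "(\<Prod>i<j. qint q (e + int i * (int s - 1))) = 0"
    by (intro prod_zero) blast+
  then show ?thesis by (simp add: Gamma_qs_def)
qed

section \<open>Partial sums, products of \<open>Gamma_qs\<close>, and their vanishing at negative
  exponents\<close>

lemma seq_sum_0 [simp]: "seq_sum 0 a = 0"
  by (simp add: seq_sum_def)

lemma seq_sum_Suc: "seq_sum (Suc m) a = seq_sum m a + a (Suc m)"
  by (simp add: seq_sum_def)

lemma seq_sum_cong: "(\<And>i. 1 \<le> i \<Longrightarrow> i \<le> m \<Longrightarrow> a i = b i) \<Longrightarrow> seq_sum m a = seq_sum m b"
  by (simp add: seq_sum_def)

lemma seq_sum_fun_upd_gt [simp]: "m < i \<Longrightarrow> seq_sum m (a(i := x)) = seq_sum m a"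
  by (rule seq_sum_cong) auto

lemma Gamma_prod_1 [simp]: "Gamma_prod q s (Suc 0) r t j = 1"
  by (simp add: Gamma_prod_def)

lemma Gamma_prod_Suc:
  "Gamma_prod q s (Suc (Suc m)) r t j = Gamma_prod q s (Suc m) r t j *
     Gamma_qs q s (j (Suc m)) (V_exponent s (Suc m) r j) (t (Suc (Suc m)))"
  by (simp add: Gamma_prod_def V_exponent_def)

lemma Gamma_prod_cong:
  "(\<And>i. 1 \<le> i \<Longrightarrow> i < n \<Longrightarrow> j i = j' i) \<Longrightarrow> Gamma_prod q s n r t j = Gamma_prod q s n r t j'"
  unfolding Gamma_prod_def
  by (intro prod.cong refl arg_cong2[of _ _ _ _ "\<lambda>x y. Gamma_qs q s x (_ + int y * _) _"] seq_sum_cong)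
    auto

lemma V_exponent_fun_upd [simp]:
  "V_exponent s (Suc m) r (j(Suc m := x)) = V_exponent s (Suc m) r j"
  by (simp add: V_exponent_def)

lemma Gamma_prod_fun_upd [simp]:
  "Gamma_prod q s (Suc m) r t (j(Suc m := x)) = Gamma_prod q s (Suc m) r t j"
  by (rule Gamma_prod_cong) auto

text \<open>If the exponent is already negative before the last step, it is so without the
  nonnegative \<open>r (Suc m)\<close> as well, and induction applies. Otherwise the last
  \<open>Gamma_qs\<close> steps across zero and vanishes.\<close>

lemma Gamma_prod_eq_0:
  assumes "int (seq_sum m r) + int (seq_sum m j) * (int s - 1) < 0"
  shows "Gamma_prod q s (Suc m) r t j = 0"
  using assms
proof (induction m)
  case 0
  then show ?case by simp
next
  case (Suc m)
  show ?case
  proof (cases "V_exponent s (Suc m) r j < 0")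
    case True
    then have "int (seq_sum m r) + int (seq_sum m j) * (int s - 1) < 0"
      by (simp add: V_exponent_def seq_sum_Suc)
    then show ?thesis by (simp add: Gamma_prod_Suc Suc.IH)
  next
    case False
    have "V_exponent s (Suc m) r j + int (j (Suc m)) * (int s - 1) < 0"
      using Suc.prems by (simp add: V_exponent_def seq_sum_Suc algebra_simps)
    with False show ?thesis
      by (simp add: Gamma_prod_Suc Gamma_qs_eq_0)
  qed
qed

lemma Gamma_prod_eq_0_V_exponent:
  assumes "n \<ge> 1" "V_exponent s n r j < 0"
  shows "Gamma_prod q s n r t j = 0"
proof -
  obtain m where "n = Suc m" using assms(1) by (cases n) auto
  with assms(2) show ?thesis
    by (auto simp: V_exponent_def seq_sum_Suc intro!: Gamma_prod_eq_0)
qed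

section \<open>Closure properties of two-sided ideals\<close>

lemma two_sided_ideal_add:
  "y \<in> two_sided_ideal G \<Longrightarrow> x \<in> two_sided_ideal G \<Longrightarrow> x + y \<in> two_sided_ideal G"
proof (induction rule: two_sided_ideal.induct)
  case (add y g a b)
  then show ?case
    using two_sided_ideal.add[of "x + y" G g a b] by (simp add: add.assoc)
qed simp

lemma two_sided_ideal_mult:
  "x \<in> two_sided_ideal G \<Longrightarrow> u * x * v \<in> two_sided_ideal G"
proof (induction rule: two_sided_ideal.induct)
  case (add x g a b)
  then show ?case
    using two_sided_ideal.add[of "u * x * v" G g "u * a" "b * v"]
    by (simp add: algebra_simps)
qed (simp add: two_sided_ideal.zero)

lemma two_sided_ideal_generator: "g \<in> G \<Longrightarrow> g \<in> two_sided_ideal G"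
  using two_sided_ideal.add[of 0 G g 1 1] by (simp add: two_sided_ideal.zero)

lemma two_sided_ideal_singleton_0: "x \<in> two_sided_ideal {0} \<Longrightarrow> x = 0"
  by (induction rule: two_sided_ideal.induct) auto

section \<open>Normal ordering of one block times a monomial, modulo an ideal\<close>

locale normal_ordering = complex_algebra scale
  for scale :: "complex \<Rightarrow> 'a::ring_1 \<Rightarrow> 'a" +
  fixes G :: "'a set" and U V :: 'a and s :: nat and h q :: complex
  assumes q_nonzero: "q \<noteq> 0"
    and relation: "U * V - scale q (V * U) - scale h (V ^ s) \<in> G"
begin

definition ideal_equiv :: "'a \<Rightarrow> 'a \<Rightarrow> bool" (infix "\<simeq>" 50) where
  "x \<simeq> y \<longleftrightarrow> x - y \<in> two_sided_ideal G"

abbreviation mono_VU :: "int \<Rightarrow> nat \<Rightarrow> 'a" where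
  "mono_VU \<equiv> VU_monomial U V"

lemma equiv_refl [simp]: "x \<simeq> x"
  by (simp add: ideal_equiv_def two_sided_ideal.zero)

lemma equiv_trans [trans]: "x \<simeq> y \<Longrightarrow> y \<simeq> z \<Longrightarrow> x \<simeq> z"
  unfolding ideal_equiv_def using two_sided_ideal_add[of "y - z" G "x - y"] by simp

lemma equiv_eq_trans [trans]: "x \<simeq> y \<Longrightarrow> y = z \<Longrightarrow> x \<simeq> z"
  by simp

lemma eq_equiv_trans [trans]: "x = y \<Longrightarrow> y \<simeq> z \<Longrightarrow> x \<simeq> z"
  by simp

lemma equiv_add: "x \<simeq> y \<Longrightarrow> x' \<simeq> y' \<Longrightarrow> x + x' \<simeq> y + y'"
  unfolding ideal_equiv_def using two_sided_ideal_add[of "x' - y'" G "x - y"] by (simp add: algebra_simps)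

lemma equiv_mult_left: "x \<simeq> y \<Longrightarrow> a * x \<simeq> a * y"
  unfolding ideal_equiv_def using two_sided_ideal_mult[of "x - y" G a 1] by (simp add: algebra_simps)

lemma equiv_mult_right: "x \<simeq> y \<Longrightarrow> x * a \<simeq> y * a"
  unfolding ideal_equiv_def using two_sided_ideal_mult[of "x - y" G 1 a] by (simp add: algebra_simps)

lemma equiv_scale: "x \<simeq> y \<Longrightarrow> scale c x \<simeq> scale c y"
  using equiv_mult_left[of x y "scale c 1"] by (simp add: scale_mult_left)

lemma equiv_sum: "(\<And>i. i \<in> A \<Longrightarrow> f i \<simeq> g i) \<Longrightarrow> sum f A \<simeq> sum g A"
  by (induction A rule: infinite_finite_induct) (auto intro: equiv_add)

lemma U_V: "U * V \<simeq> scale q (V * U) + scale h (V ^ s)"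
  using two_sided_ideal_generator[OF relation] by (simp add: ideal_equiv_def algebra_simps)

text \<open>The exponent \<open>a + s - 1\<close> is truncated only for \<open>a = s = 0\<close>, where the coefficient vanishes.\<close>

lemma U_V_power:
  "U * V ^ a \<simeq> scale (q ^ a) (V ^ a * U) + scale (h * qint q (int a)) (V ^ (a + s - 1))"
proof (induction a)
  case 0
  show ?case by simp
next
  case (Suc a)
  \<comment> \<open>For \<open>a = 0\<close> the scalar contains \<open>[0]_q\<close> and both sides
    vanish; otherwise nothing is truncated.\<close>
  have shift: "scale (h * qint q (int a)) (V ^ (a + s - 1) * V) = scale (h * qint q (int a)) (V ^ (a + s))"
    by (cases a) (simp_all add: power_commutes)
  have "U * V ^ Suc a = (U * V ^ a) * V"
    by (simp add: power_commutes mult.assoc)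
  also have "\<dots> \<simeq> (scale (q ^ a) (V ^ a * U) + scale (h * qint q (int a)) (V ^ (a + s - 1))) * V"
    by (intro equiv_mult_right Suc.IH)
  also have "\<dots> = scale (q ^ a) (V ^ a * (U * V)) + scale (h * qint q (int a)) (V ^ (a + s))"
    by (simp only: distrib_right scale_mult_left mult.assoc shift)
  also have "\<dots> \<simeq> scale (q ^ a) (V ^ a * (scale q (V * U) + scale h (V ^ s)))
      + scale (h * qint q (int a)) (V ^ (a + s))"
    by (intro equiv_add equiv_scale equiv_mult_left U_V equiv_refl)
  also have "\<dots> = scale (q ^ Suc a) (V ^ Suc a * U) + scale (h * qint q (int (Suc a))) (V ^ (Suc a + s - 1))"
  proof -
    have "qint q (int (Suc a)) = qint q (int a) + q ^ a"
      using qint_plus_one[OF q_nonzero, of "int a"] by (simp add: add.commute)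
    moreover have "V ^ a * (V * U) = V ^ Suc a * U" "V ^ a * V ^ s = V ^ (Suc a + s - 1)"
      by (simp_all add: power_commutes power_add flip: mult.assoc)
    ultimately show ?thesis
      by (simp add: scale_mult_right distrib_left scale_right_distrib scale_left_distrib
          mult_ac add_ac del: power_Suc) (simp add: mult.commute)
  qed
  finally show ?case .
qed

text \<open>For negative \<open>e\<close> the left side is read as 0, so the right side must be 0
  too; \<open>s = 0\<close> ensures that \<open>e + s - 1\<close> is still negative.\<close>

lemma U_mono_VU:
  assumes "e \<ge> 0 \<or> s = 0"
  shows "U * mono_VU e k \<simeq> scale (q powi e) (mono_VU e (Suc k))
    + scale (h * qint q e) (mono_VU (e + (int s - 1)) k)"
proof (cases "e \<ge> 0")
  case True
  then obtain a where a: "e = int a" using nonneg_int_cases by blast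
  have "U * mono_VU e k = (U * V ^ a) * U ^ k"
    by (simp add: a VU_monomial_def mult.assoc)
  also have "\<dots> \<simeq> (scale (q ^ a) (V ^ a * U) + scale (h * qint q (int a)) (V ^ (a + s - 1))) * U ^ k"
    by (intro equiv_mult_right U_V_power)
  also have "\<dots> = scale (q powi e) (mono_VU e (Suc k)) + scale (h * qint q e) (mono_VU (e + (int s - 1)) k)"
  \<comment> \<open>In the exceptional case \<open>V ^ (a + s - 1)\<close> truncates to 1 while the
    monomial of exponent -1 is 0; the scalar \<open>qint q 0\<close> removes both.\<close>
  proof (cases "a = 0 \<and> s = 0")
    case False
    then have "nat (int a + (int s - 1)) = a + s - 1" "\<not> int a + (int s - 1) < 0" by auto
    then show ?thesis
      by (simp add: a VU_monomial_def distrib_right scale_mult_left mult.assoc)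
  qed (simp add: a VU_monomial_def distrib_right scale_mult_left mult.assoc)
  finally show ?thesis .
next
  case False
  with assms show ?thesis by (simp add: VU_monomial_def)
qed

text \<open>One more \<open>U\<close> turns the j-th term into \<open>A j\<close> on the monomial
  \<open>M j\<close> and \<open>B j\<close> on \<open>M (Suc j)\<close>. Collecting coefficients of
  each \<open>M j\<close> gives exactly the recurrence for \<open>Gamma_qs\<close>.\<close>

lemma U_power_mono_VU:
  assumes "e \<ge> 0 \<or> s = 0"
  shows "U ^ m * mono_VU e k \<simeq>
    (\<Sum>j\<le>m. scale (h ^ j * Gamma_qs q s j e m) (mono_VU (e + int j * (int s - 1)) (m - j + k)))"
proof (induction m)
  case 0
  show ?case by simp
next
  case (Suc m)
  define E where "E j = e + int j * (int s - 1)" for j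
  define M where "M j = mono_VU (E j) (Suc m - j + k)" for j
  define A where "A j = scale (h ^ j * (q powi E j * Gamma_qs q s j e m)) (M j)" for j
  define B where "B j = scale (h ^ Suc j * (qint q (E j) * Gamma_qs q s j e m)) (M (Suc j))" for j
  have E: "E j \<ge> 0 \<or> s = 0" for j
    using assms by (cases s) (auto simp: E_def)
  have E_Suc: "E j + (int s - 1) = E (Suc j)" for j
    by (simp add: E_def algebra_simps)
  have "U ^ Suc m * mono_VU e k = U * (U ^ m * mono_VU e k)"
    by (simp add: mult.assoc)
  also have "\<dots> \<simeq> U * (\<Sum>j\<le>m. scale (h ^ j * Gamma_qs q s j e m) (mono_VU (E j) (m - j + k)))"
    unfolding E_def by (intro equiv_mult_left Suc.IH)
  also have "\<dots> = (\<Sum>j\<le>m. scale (h ^ j * Gamma_qs q s j e m) (U * mono_VU (E j) (m - j + k)))"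
    by (simp add: sum_distrib_left scale_mult_right)
  also have "\<dots> \<simeq> (\<Sum>j\<le>m. scale (h ^ j * Gamma_qs q s j e m)
      (scale (q powi E j) (mono_VU (E j) (Suc (m - j + k)))
        + scale (h * qint q (E j)) (mono_VU (E j + (int s - 1)) (m - j + k))))"
    by (intro equiv_sum equiv_scale U_mono_VU E)
  also have "\<dots> = (\<Sum>j\<le>m. A j + B j)"
    by (intro sum.cong refl)
      (simp add: A_def B_def M_def scale_right_distrib Suc_diff_le E_Suc mult_ac)
  \<comment> \<open>The added summand \<open>A (Suc m)\<close> is 0 since \<open>Gamma_qs\<close>
    vanishes for \<open>j > m\<close>; it aligns the ranges once \<open>A 0\<close> is split
    off.\<close>
  also have "\<dots> = (\<Sum>j\<le>Suc m. A j) + (\<Sum>j\<le>m. B j)"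
    by (simp add: sum.distrib A_def Gamma_qs_gt)
  also have "\<dots> = A 0 + (\<Sum>j\<le>m. A (Suc j) + B j)"
    by (simp add: sum.atMost_Suc_shift sum.distrib del: sum.atMost_Suc)
  also have "\<dots> = (\<Sum>j\<le>Suc m. scale (h ^ j * Gamma_qs q s j e (Suc m)) (M j))"
    unfolding sum.atMost_Suc_shift
    by (simp add: A_def B_def E_def Gamma_qs_0_Suc Gamma_qs_Suc_Suc q_nonzero
        distrib_left scale_left_distrib del: power_Suc)
  finally show ?case by (simp add: M_def E_def)
qed

lemma V_power_mono_VU: "e \<ge> 0 \<Longrightarrow> V ^ a * mono_VU e k = mono_VU (int a + e) k"
  by (simp add: VU_monomial_def nat_add_distrib power_add mult.assoc)

text \<open>A factor \<open>V ^ a\<close> may lift a negative exponent back to a nonnegative one,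
  although the monomial was already read as 0. Hence the coefficient must vanish at negative
  exponents: by assumption at \<open>e\<close>, by \<open>Gamma_qs_eq_0\<close> after a step below
  zero.\<close>

lemma V_U_power_mono_VU:
  assumes "e \<ge> 0 \<or> s = 0" "e < 0 \<Longrightarrow> c = 0"
  shows "scale c (V ^ a * U ^ m * mono_VU e k) \<simeq>
    (\<Sum>j\<le>m. scale (c * (h ^ j * Gamma_qs q s j e m))
      (mono_VU (int a + (e + int j * (int s - 1))) (m - j + k)))"
proof -
  have "scale c (V ^ a * U ^ m * mono_VU e k) = scale c (V ^ a * (U ^ m * mono_VU e k))"
    by (simp add: mult.assoc)
  also have "\<dots> \<simeq> scale c (V ^ a * (\<Sum>j\<le>m. scale (h ^ j * Gamma_qs q s j e m)
      (mono_VU (e + int j * (int s - 1)) (m - j + k))))"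
    by (intro equiv_scale equiv_mult_left U_power_mono_VU assms)
  also have "\<dots> = (\<Sum>j\<le>m. scale (c * (h ^ j * Gamma_qs q s j e m))
      (V ^ a * mono_VU (e + int j * (int s - 1)) (m - j + k)))"
    by (simp add: sum_distrib_left scale_mult_right scale_sum_right)
  also have "\<dots> = (\<Sum>j\<le>m. scale (c * (h ^ j * Gamma_qs q s j e m))
      (mono_VU (int a + (e + int j * (int s - 1))) (m - j + k)))"
  proof (intro sum.cong refl)
    fix j
    show "scale (c * (h ^ j * Gamma_qs q s j e m)) (V ^ a * mono_VU (e + int j * (int s - 1)) (m - j + k))
      = scale (c * (h ^ j * Gamma_qs q s j e m)) (mono_VU (int a + (e + int j * (int s - 1))) (m - j + k))"
    proof (cases "e + int j * (int s - 1) < 0")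
      case True
      then have "c * Gamma_qs q s j e m = 0"
        using assms(2) Gamma_qs_eq_0[of e j s] by (cases "e < 0") auto
      then show ?thesis by auto
    qed (simp add: V_power_mono_VU)
  qed
  finally show ?thesis .
qed

end

section \<open>Index tuples and the expansion of \<open>H_word\<close>\<close>

lemma seq_sum_mono: "(\<And>i. 1 \<le> i \<Longrightarrow> i \<le> m \<Longrightarrow> a i \<le> b i) \<Longrightarrow> seq_sum m a \<le> seq_sum m b"
  unfolding seq_sum_def by (rule sum_mono) auto

lemma seq_sum_shift: "seq_sum (Suc m) a = a 1 + seq_sum m (\<lambda>i. a (i + 1))"
  by (induction m) (simp_all add: seq_sum_Suc)

lemma H_word_Suc: "H_word U V (Suc n) r t = V ^ r (Suc n) * U ^ t (Suc n) * H_word U V n r t"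
  by (simp add: H_word_def)

text \<open>Extensionality fixes the values outside \<open>{1..m}\<close>, so each tuple is counted
  once.\<close>

definition index_box :: "nat \<Rightarrow> (nat \<Rightarrow> nat) \<Rightarrow> (nat \<Rightarrow> nat) set" where
  "index_box m t = (\<Pi>\<^sub>E i\<in>{1..m}. {0..t (i + 1)})"

lemma finite_index_box [simp]: "finite (index_box m t)"
  by (simp add: index_box_def finite_PiE)

text \<open>Makes the truncated subtraction in the exponent of \<open>U\<close> exact, and that
  exponent at least \<open>t 1\<close>.\<close>

lemma index_box_seq_sum_le:
  "j \<in> index_box m t \<Longrightarrow> t 1 + seq_sum m j \<le> seq_sum (Suc m) t"
  by (auto simp: seq_sum_shift index_box_def PiE_iff intro!: seq_sum_mono)

text \<open>Every longer tuple arises from exactly one shorter tuple and one last entry, so the sum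
  can be reindexed along \<open>fun_upd\<close>.\<close>

lemma sum_index_box_Suc:
  "(\<Sum>j\<in>index_box (Suc m) t. f j) =
    (\<Sum>j\<in>index_box m t. \<Sum>x\<le>t (Suc (Suc m)). f (j(Suc m := x)))"
proof -
  let ?C = "(\<lambda>(x, j). j(Suc m := x)) ` ({..t (Suc (Suc m))} \<times> index_box m t)"
  have ins: "{1..Suc m} = insert (Suc m) {1..m}" by auto
  have "index_box (Suc m) t = ?C"
    unfolding index_box_def ins PiE_insert_eq by (simp add: atLeast0AtMost)
  moreover have "inj_on (\<lambda>(x, j). j(Suc m := x)) ({..t (Suc (Suc m))} \<times> index_box m t)"
    unfolding index_box_def by (rule inj_on_subset[OF inj_combinator[of "Suc m" "{1..m}" "\<lambda>i. {..t (i + 1)}"]])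
      (auto simp: atLeast0AtMost)
  ultimately have "(\<Sum>j\<in>index_box (Suc m) t. f j) =
      (\<Sum>(x, j)\<in>{..t (Suc (Suc m))} \<times> index_box m t. f (j(Suc m := x)))"
    by (simp add: sum.reindex case_prod_unfold)
  also have "\<dots> = (\<Sum>x\<le>t (Suc (Suc m)). \<Sum>j\<in>index_box m t. f (j(Suc m := x)))"
    by (rule sum.cartesian_product[symmetric])
  finally show ?thesis by (subst sum.swap) simp
qed

context normal_ordering
begin

lemma V_exponent_nonneg: "V_exponent s n r j \<ge> 0 \<or> s = 0"
  by (cases s) (auto simp: V_exponent_def)

text \<open>Each new block is multiplied on the left and normal ordered against every term so far;
  the new index \<open>x\<close> counts the letters \<open>U\<close> of that block absorbed by the
  relation.\<close>

lemma H_word_equiv: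
  "H_word U V (Suc m) r t \<simeq>
    (\<Sum>j\<in>index_box m t. scale (h ^ seq_sum m j * Gamma_prod q s (Suc m) r t j)
      (mono_VU (V_exponent s (Suc m) r j) (seq_sum (Suc m) t - seq_sum m j)))"
proof (induction m)
  case 0
  show ?case
    by (simp add: index_box_def H_word_def V_exponent_def seq_sum_Suc VU_monomial_def)
next
  case (Suc m)
  let ?c = "\<lambda>j. h ^ seq_sum m j * Gamma_prod q s (Suc m) r t j"
  let ?e = "\<lambda>j. V_exponent s (Suc m) r j"
  let ?k = "\<lambda>j. seq_sum (Suc m) t - seq_sum m j"
  let ?a = "r (Suc (Suc m))" and ?b = "t (Suc (Suc m))"
  have "H_word U V (Suc (Suc m)) r t = V ^ ?a * U ^ ?b * H_word U V (Suc m) r t"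
    by (rule H_word_Suc)
  also have "\<dots> \<simeq> V ^ ?a * U ^ ?b * (\<Sum>j\<in>index_box m t. scale (?c j) (mono_VU (?e j) (?k j)))"
    by (intro equiv_mult_left Suc.IH)
  also have "\<dots> = (\<Sum>j\<in>index_box m t. scale (?c j) (V ^ ?a * U ^ ?b * mono_VU (?e j) (?k j)))"
    by (simp only: sum_distrib_left scale_mult_right)
  also have "\<dots> \<simeq> (\<Sum>j\<in>index_box m t. \<Sum>x\<le>?b. scale (?c j * (h ^ x * Gamma_qs q s x (?e j) ?b))
      (mono_VU (int ?a + (?e j + int x * (int s - 1))) (?b - x + ?k j)))"
  proof (rule equiv_sum, rule V_U_power_mono_VU)
    show "?e j < 0 \<Longrightarrow> ?c j = 0" for j
      by (simp add: Gamma_prod_eq_0_V_exponent)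
  qed (rule V_exponent_nonneg)
  also have "\<dots> = (\<Sum>j\<in>index_box m t. \<Sum>x\<le>?b.
      scale (h ^ seq_sum (Suc m) (j(Suc m := x)) * Gamma_prod q s (Suc (Suc m)) r t (j(Suc m := x)))
      (mono_VU (V_exponent s (Suc (Suc m)) r (j(Suc m := x)))
        (seq_sum (Suc (Suc m)) t - seq_sum (Suc m) (j(Suc m := x)))))"
  proof (intro sum.cong refl)
    fix j x assume jx: "j \<in> index_box m t" "x \<in> {..?b}"
    have "?b - x + ?k j = seq_sum (Suc (Suc m)) t - seq_sum (Suc m) (j(Suc m := x))"
      using index_box_seq_sum_le[OF jx(1)] jx(2) by (simp add: seq_sum_Suc)
    moreover have "int ?a + (?e j + int x * (int s - 1)) = V_exponent s (Suc (Suc m)) r (j(Suc m := x))"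
      by (simp add: V_exponent_def seq_sum_Suc algebra_simps)
    moreover have "?c j * (h ^ x * Gamma_qs q s x (?e j) ?b) =
        h ^ seq_sum (Suc m) (j(Suc m := x)) * Gamma_prod q s (Suc (Suc m)) r t (j(Suc m := x))"
      by (simp add: Gamma_prod_Suc seq_sum_Suc power_add)
    ultimately show "scale (?c j * (h ^ x * Gamma_qs q s x (?e j) ?b))
      (mono_VU (int ?a + (?e j + int x * (int s - 1))) (?b - x + ?k j)) =
      scale (h ^ seq_sum (Suc m) (j(Suc m := x)) * Gamma_prod q s (Suc (Suc m)) r t (j(Suc m := x)))
      (mono_VU (V_exponent s (Suc (Suc m)) r (j(Suc m := x)))
        (seq_sum (Suc (Suc m)) t - seq_sum (Suc m) (j(Suc m := x))))"
      by simp
  qed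
  finally show ?case by (simp only: sum_index_box_Suc)
qed

end

section \<open>Action of the free algebra on coefficient functions, and uniqueness of normal
  forms\<close>

text \<open>Here \<open>f i j\<close> is the coefficient of \<open>V\<^sup>i U\<^sup>j\<close>; the letter \<open>U\<close> sends \<open>V\<^sup>i U\<^sup>j\<close> to
  \<open>q\<^sup>i V\<^sup>i U\<^bsup>j+1\<^esup> + h [i]\<^sub>q V\<^bsup>i+s-1\<^esup> U\<^sup>j\<close>.\<close>

context
  fixes s :: nat and h q :: complex
begin

fun letter_act :: "letter \<Rightarrow> (nat \<Rightarrow> nat \<Rightarrow> complex) \<Rightarrow> nat \<Rightarrow> nat \<Rightarrow> complex" where
  "letter_act V_letter f i j = (if i = 0 then 0 else f (i - 1) j)"
| "letter_act U_letter f i j = q ^ i * (if j = 0 then 0 else f i (j - 1)) +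
    (if s \<le> Suc i then h * qint q (int (Suc i - s)) * f (Suc i - s) j else 0)"

definition word_act :: "word \<Rightarrow> (nat \<Rightarrow> nat \<Rightarrow> complex) \<Rightarrow> nat \<Rightarrow> nat \<Rightarrow> complex" where
  "word_act w f = foldr letter_act (letters w) f"

text \<open>The linear extension of \<open>word_act\<close>. Arbitrary functions can serve as
  vectors because each value of \<open>letter_act\<close> depends on at most two values of its
  argument.\<close>

definition free_act :: "free_alg \<Rightarrow> (nat \<Rightarrow> nat \<Rightarrow> complex) \<Rightarrow> nat \<Rightarrow> nat \<Rightarrow> complex" where
  "free_act p f = (\<lambda>i j. \<Sum>w\<in>Poly_Mapping.keys p. Poly_Mapping.lookup p w * word_act w f i j)"

lemma word_act_0 [simp]: "word_act 0 f = f"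
  by (simp add: word_act_def zero_word_def)

lemma word_act_plus: "word_act (v + w) f = word_act v (word_act w f)"
  by (simp add: word_act_def plus_word_def)

lemma letter_act_linear:
  "letter_act l (\<lambda>i j. a * f i j + b * g i j) = (\<lambda>i j. a * letter_act l f i j + b * letter_act l g i j)"
  by (cases l) (auto simp: fun_eq_iff algebra_simps)

lemma word_act_linear:
  "word_act w (\<lambda>i j. a * f i j + b * g i j) = (\<lambda>i j. a * word_act w f i j + b * word_act w g i j)"
proof -
  have "foldr letter_act ls (\<lambda>i j. a * f i j + b * g i j) =
      (\<lambda>i j. a * foldr letter_act ls f i j + b * foldr letter_act ls g i j)" for ls
    by (induction ls) (simp_all add: letter_act_linear)
  then show ?thesis by (simp add: word_act_def)
qed

text \<open>Allows summands and their sum, whose support may shrink by cancellation, to be expanded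
  over one common set of words.\<close>

lemma free_act_superset:
  assumes "finite A" "Poly_Mapping.keys p \<subseteq> A"
  shows "free_act p f i j = (\<Sum>w\<in>A. Poly_Mapping.lookup p w * word_act w f i j)"
  unfolding free_act_def using assms
  by (intro sum.mono_neutral_left) (auto simp: in_keys_iff)

lemma free_act_zero [simp]: "free_act 0 f = (\<lambda>i j. 0)"
  by (simp add: free_act_def)

lemma free_act_add: "free_act (p + p') f = (\<lambda>i j. free_act p f i j + free_act p' f i j)"
proof (intro ext)
  fix i j
  let ?A = "Poly_Mapping.keys p \<union> Poly_Mapping.keys p'"
  have "free_act x f i j = (\<Sum>w\<in>?A. Poly_Mapping.lookup x w * word_act w f i j)"
    if "x \<in> {p, p', p + p'}" for x
    using that Poly_Mapping.keys_add[of p p'] by (intro free_act_superset) auto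
  then show "free_act (p + p') f i j = free_act p f i j + free_act p' f i j"
    by (simp add: lookup_add distrib_right sum.distrib)
qed

lemma free_act_diff: "free_act (p - p') f = (\<lambda>i j. free_act p f i j - free_act p' f i j)"
  using free_act_add[of "p - p'" p' f] by (simp add: fun_eq_iff)

lemma free_act_sum: "free_act (\<Sum>x\<in>X. p x) f i j = (\<Sum>x\<in>X. free_act (p x) f i j)"
  by (induction X rule: infinite_finite_induct) (simp_all add: free_act_add)

lemma free_act_single: "free_act (Poly_Mapping.single w c) f = (\<lambda>i j. c * word_act w f i j)"
  by (simp add: free_act_def fun_eq_iff)

lemma free_act_linear:
  "free_act p (\<lambda>i j. a * f i j + b * g i j) = (\<lambda>i j. a * free_act p f i j + b * free_act p g i j)"
  by (simp add: free_act_def fun_eq_iff word_act_linear distrib_left sum.distrib sum_distrib_left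
      algebra_simps)

lemma free_act_on_zero [simp]: "free_act p (\<lambda>i j. 0) = (\<lambda>i j. 0)"
  using free_act_linear[of p 0 "\<lambda>i j. 0" 0 "\<lambda>i j. 0"] by simp

lemma update_eq_add:
  "a \<notin> Poly_Mapping.keys p \<Longrightarrow> Poly_Mapping.update a b p = Poly_Mapping.single a b + p"
  for p :: free_alg
  by (intro poly_mapping_eqI) (auto simp: lookup_update lookup_add lookup_single in_keys_iff when_def)

text \<open>The case of a single word on the left; \<open>free_act_mult\<close> extends it by
  additivity, so that products act by composition.\<close>

lemma free_act_single_mult:
  "free_act (Poly_Mapping.single v c * p) f = free_act (Poly_Mapping.single v c) (free_act p f)"
proof (induction p rule: update_induct)
  case const
  show ?case by simp
next
  case (update p w b)
  have "word_act v (\<lambda>i j. b * word_act w f i j + free_act p f i j) =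
      (\<lambda>i j. b * word_act v (word_act w f) i j + word_act v (free_act p f) i j)"
    using word_act_linear[of v b "word_act w f" 1 "free_act p f"] by simp
  then show ?case
    using update(3)
    by (simp add: update_eq_add[OF update(1)] distrib_left mult_single free_act_add
        free_act_single word_act_plus fun_eq_iff algebra_simps)
qed

lemma free_act_mult: "free_act (p * p') f = free_act p (free_act p' f)"
proof (induction p rule: update_induct)
  case const
  show ?case by simp
next
  case (update p w b)
  then show ?case
    by (simp add: update_eq_add distrib_right free_act_add free_act_single_mult)
qed

lemma free_act_scale: "free_act (free_scale c p) f = (\<lambda>i j. c * free_act p f i j)"
  by (simp add: free_scale_def free_act_mult free_act_single)

lemma free_act_U: "free_act free_U f = letter_act U_letter f"
  by (simp add: free_U_def free_act_single word_act_def fun_eq_iff)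

lemma free_act_V: "free_act free_V f = letter_act V_letter f"
  by (simp add: free_V_def free_act_single word_act_def fun_eq_iff)

lemma free_act_1 [simp]: "free_act 1 f = f"
  using free_act_single[of 0 1 f] by simp

lemma free_act_V_power: "free_act (free_V ^ n) f = (\<lambda>i j. if n \<le> i then f (i - n) j else 0)"
proof (induction n)
  case (Suc n)
  show ?case
    by (auto simp: free_act_mult Suc.IH free_act_V fun_eq_iff)
qed simp

text \<open>The terms containing a \<open>U\<close> cancel, and the rest amounts to
  \<open>[d+1]_q = q [d]_q + 1\<close> with \<open>d = i - s\<close>.\<close>

lemma free_act_relation:
  assumes "q \<noteq> 0"
  shows "free_act (free_U * free_V - free_scale q (free_V * free_U) - free_scale h (free_V ^ s)) f
    = (\<lambda>i j. 0)"
proof (intro ext)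
  fix i j
  let ?U = "letter_act U_letter" and ?V = "letter_act V_letter"
  let ?g = "if s \<le> i then f (i - s) j else 0"
  have "?U (?V f) i j = q * ?V (?U f) i j + h * ?g"
  proof (cases "s \<le> i")
    case True
    then obtain d where d: "i = s + d" using le_Suc_ex by blast
    have "qint q (1 + int d) = q * qint q (int d) + 1"
      using assms by (simp add: qint_def power_int_add divide_simps algebra_simps)
    moreover have "q * q ^ (i - 1) = q ^ i" if "i > 0"
      using that by (cases i) auto
    ultimately show ?thesis
      unfolding d letter_act.simps by (cases "s + d = 0") (auto simp: algebra_simps)
  next
    case False
    \<comment> \<open>Only \<open>s = i + 1\<close> passes the guard, and there the factor
      \<open>[0]_q\<close> appears.\<close>
    then have "s \<le> Suc i \<Longrightarrow> Suc i - s = 0" "\<not> s \<le> i" by auto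
    then show ?thesis unfolding letter_act.simps by (cases i) auto
  qed
  then show "free_act (free_U * free_V - free_scale q (free_V * free_U) - free_scale h (free_V ^ s)) f i j = 0"
    unfolding free_act_diff free_act_scale free_act_mult free_act_U free_act_V free_act_V_power by simp
qed

lemma free_act_ideal:
  assumes "\<And>f. free_act g f = (\<lambda>i j. 0)" "z \<in> two_sided_ideal {g}"
  shows "free_act z f = (\<lambda>i j. 0)"
  using assms(2) by (induction rule: two_sided_ideal.induct) (auto simp: free_act_add free_act_mult assms(1))

text \<open>The action descends to the quotient, so elements that act differently are not
  congruent.\<close>

lemma free_act_quot_eq:
  assumes "q \<noteq> 0" "quot_eq s h q x y"
  shows "free_act x f = free_act y f"
  using free_act_ideal[OF free_act_relation[OF assms(1)] assms(2)[unfolded quot_eq_def], of f]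
  by (simp add: free_act_diff fun_eq_iff)

definition delta :: "nat \<Rightarrow> nat \<Rightarrow> nat \<Rightarrow> nat \<Rightarrow> complex" where
  "delta a b i j = (if i = a \<and> j = b then 1 else 0)"

lemma free_act_U_power_delta: "free_act (free_U ^ k) (delta 0 0) = delta 0 k"
proof (induction k)
  case (Suc k)
  have "letter_act U_letter (delta 0 k) i j = delta 0 (Suc k) i j" for i j
    \<comment> \<open>The second term of the action of \<open>U\<close> meets the support of
      \<open>delta 0 k\<close> only at \<open>Suc i - s = 0\<close>, where its factor is
      \<open>[0]_q\<close>.\<close>
    by (cases "Suc i - s = 0") (auto simp: delta_def)
  then show ?case
    by (simp add: free_act_mult Suc.IH free_act_U fun_eq_iff del: letter_act.simps)
qed simp

lemma free_act_VU_monomial_delta: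
  "free_act (VU_monomial free_U free_V e k) (delta 0 0) = (if e < 0 then \<lambda>i j. 0 else delta (nat e) k)"
  by (auto simp: VU_monomial_def free_act_mult free_act_U_power_delta free_act_V_power
      fun_eq_iff delta_def)

text \<open>Applied to \<open>delta 0 0\<close>, monomials with different \<open>k\<close> give
  basis vectors with different second index, so the value at \<open>(E k, k)\<close> is
  \<open>c k\<close> alone.\<close>

lemma normal_form_unique:
  assumes "q \<noteq> 0" "finite K"
    and "quot_eq s h q (\<Sum>k\<in>K. free_scale (c k) (VU_monomial free_U free_V (E k) k))
      (\<Sum>k\<in>K. free_scale (c' k) (VU_monomial free_U free_V (E k) k))"
    and "k \<in> K" "E k \<ge> 0"
  shows "c k = c' k"
proof -
  have "free_act (\<Sum>k\<in>K. free_scale (c k) (VU_monomial free_U free_V (E k) k)) (delta 0 0) (nat (E k)) k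
      = c k" for c
  proof -
    have "free_act (\<Sum>k\<in>K. free_scale (c k) (VU_monomial free_U free_V (E k) k)) (delta 0 0) (nat (E k)) k
      = (\<Sum>l\<in>K. if l = k then c l else 0)"
      unfolding free_act_sum
      by (intro sum.cong refl)
        (use assms(5) in \<open>auto simp: free_act_scale free_act_VU_monomial_delta delta_def\<close>)
    with assms show ?thesis by simp
  qed
  from this[of c] this[of c'] show ?thesis
    by (simp only: free_act_quot_eq[OF assms(1,3)])
qed

end

section \<open>The normal ordering coefficients in the quotient algebra\<close>

lemma quot_eq_sym: "quot_eq s h q x y \<Longrightarrow> quot_eq s h q y x"
  using two_sided_ideal_mult[of "x - y" _ "- 1" 1] by (auto simp: quot_eq_def)

lemma quot_eq_trans: "quot_eq s h q x y \<Longrightarrow> quot_eq s h q y z \<Longrightarrow> quot_eq s h q x z"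
  using two_sided_ideal_add[of "y - z" _ "x - y"] by (auto simp: quot_eq_def)

lemma Gamma_prod_outside_box:
  assumes "j \<in> {1..m} \<rightarrow>\<^sub>E UNIV" "j \<notin> index_box m t"
  shows "Gamma_prod q s (Suc m) r t j = 0"
proof -
  obtain i where "i \<in> {1..m}" "t (i + 1) < j i"
    using assms by (auto simp: index_box_def PiE_iff not_le)
  then show ?thesis
    unfolding Gamma_prod_def by (intro prod_zero bexI[of _ i]) (auto simp: Gamma_qs_gt)
qed

text \<open>The coefficient formula ranges over all tuples of a given total, the expansion only over
  the box; outside the box some Gaussian coefficient is 0.\<close>

lemma sum_Gamma_prod_box:
  "(\<Sum>j\<in>{j \<in> {1..m} \<rightarrow>\<^sub>E UNIV. seq_sum m j = d}. Gamma_prod q s (Suc m) r t j) =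
    (\<Sum>j\<in>{j \<in> index_box m t. seq_sum m j = d}. Gamma_prod q s (Suc m) r t j)"
proof (rule sum.mono_neutral_right)
  \<comment> \<open>Each entry is bounded by the total, which gives finiteness.\<close>
  have "j i \<le> seq_sum m j" if "i \<in> {1..m}" for i j
    unfolding seq_sum_def using that by (intro member_le_sum) auto
  then have "{j \<in> {1..m} \<rightarrow>\<^sub>E UNIV. seq_sum m j = d} \<subseteq> {1..m} \<rightarrow>\<^sub>E {0..d}"
    by (fastforce simp: PiE_iff)
  then show "finite {j \<in> {1..m} \<rightarrow>\<^sub>E UNIV. seq_sum m j = d}"
    by (rule finite_subset) (simp add: finite_PiE)
  show "{j \<in> index_box m t. seq_sum m j = d} \<subseteq> {j \<in> {1..m} \<rightarrow>\<^sub>E UNIV. seq_sum m j = d}"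
    unfolding index_box_def using PiE_mono[of "{1..m}" _ "\<lambda>_. UNIV"] by blast
qed (auto intro!: Gamma_prod_outside_box)

lemma normal_ordering_free:
  assumes "q \<noteq> 0"
  shows "normal_ordering free_scale
    {free_U * free_V - free_scale q (free_V * free_U) - free_scale h (free_V ^ s)} free_U free_V s h q"
  using assms by (intro normal_ordering.intro complex_algebra_free normal_ordering_axioms.intro) auto

lemma H_word_quot_eq:
  assumes "q \<noteq> 0"
  shows "quot_eq s h q (H_word free_U free_V (Suc m) r t)
    (\<Sum>j\<in>index_box m t. free_scale (h ^ seq_sum m j * Gamma_prod q s (Suc m) r t j)
      (VU_monomial free_U free_V (V_exponent s (Suc m) r j) (seq_sum (Suc m) t - seq_sum m j)))"
  using normal_ordering.H_word_equiv[OF normal_ordering_free[OF assms], where m = m and r = r and t = t]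
  unfolding quot_eq_def normal_ordering.ideal_equiv_def[OF normal_ordering_free[OF assms]] .

lemma V_exponent_eq_S_V_exponent:
  assumes "k \<le> seq_sum (Suc m) t" "seq_sum m j = seq_sum (Suc m) t - k"
  shows "V_exponent s (Suc m) r j = S_V_exponent s (Suc m) r t k"
  using assms by (simp add: V_exponent_def S_V_exponent_def of_nat_diff algebra_simps)

text \<open>Grouping by the exponent \<open>k\<close> of \<open>U\<close> fixes the total of
  \<open>j\<close>, and with it the power of \<open>h\<close> and the exponent of
  \<open>V\<close>.\<close>

lemma sum_box_by_degree:
  fixes scale :: "complex \<Rightarrow> 'a::ring_1 \<Rightarrow> 'a"
  assumes "complex_algebra scale"
  shows "(\<Sum>j\<in>index_box m t. scale (h ^ seq_sum m j * Gamma_prod q s (Suc m) r t j)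
      (VU_monomial U V (V_exponent s (Suc m) r j) (seq_sum (Suc m) t - seq_sum m j))) =
    (\<Sum>k = t 1..seq_sum (Suc m) t.
      scale (h ^ (seq_sum (Suc m) t - k) *
        (\<Sum>j\<in>{j \<in> {1..m} \<rightarrow>\<^sub>E UNIV. seq_sum m j = seq_sum (Suc m) t - k}. Gamma_prod q s (Suc m) r t j))
      (VU_monomial U V (S_V_exponent s (Suc m) r t k) k))" (is "sum ?f _ = _")
proof -
  interpret complex_algebra scale by fact
  let ?T = "seq_sum (Suc m) t"
  have "sum ?f (index_box m t) =
      (\<Sum>k = t 1..?T. \<Sum>j\<in>{j \<in> index_box m t. ?T - seq_sum m j = k}. ?f j)"
  proof (rule sum.group[symmetric])
    show "(\<lambda>j. ?T - seq_sum m j) ` index_box m t \<subseteq> {t 1..?T}"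
    proof
      fix k assume "k \<in> (\<lambda>j. ?T - seq_sum m j) ` index_box m t"
      then obtain j where "k = ?T - seq_sum m j" "t 1 + seq_sum m j \<le> ?T"
        using index_box_seq_sum_le by blast
      then show "k \<in> {t 1..?T}" by simp
    qed
  qed auto
  also have "\<dots> = (\<Sum>k = t 1..?T.
      \<Sum>j\<in>{j \<in> index_box m t. seq_sum m j = ?T - k}.
        scale (h ^ (?T - k) * Gamma_prod q s (Suc m) r t j)
          (VU_monomial U V (S_V_exponent s (Suc m) r t k) k))"
  proof (intro sum.cong refl)
    fix k assume k: "k \<in> {t 1..?T}"
    show "{j \<in> index_box m t. ?T - seq_sum m j = k} = {j \<in> index_box m t. seq_sum m j = ?T - k}"
    proof (rule Collect_cong, rule conj_cong[OF refl])
      fix j assume "j \<in> index_box m t"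
      then have "t 1 + seq_sum m j \<le> ?T" by (rule index_box_seq_sum_le)
      with k show "(?T - seq_sum m j = k) = (seq_sum m j = ?T - k)" by auto
    qed
    fix j assume "j \<in> {j \<in> index_box m t. seq_sum m j = ?T - k}"
    then have "V_exponent s (Suc m) r j = S_V_exponent s (Suc m) r t k"
      using k by (intro V_exponent_eq_S_V_exponent) auto
    with \<open>j \<in> _\<close> show "?f j = scale (h ^ (?T - k) * Gamma_prod q s (Suc m) r t j)
          (VU_monomial U V (S_V_exponent s (Suc m) r t k) k)"
      using k by auto
  qed
  finally show ?thesis
    by (simp only: sum_Gamma_prod_box sum_distrib_left scale_sum_left)
qed

text \<open>The grouped expansion supplies a family meeting the description in
  \<open>S_coeff\<close>; uniqueness of normal forms shows it is the only one.\<close>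

lemma S_coeff_eq:
  assumes "q \<noteq> 0" "k \<in> {t 1..seq_sum (Suc m) t}"
  shows "S_coeff s h q (Suc m) r t k = h ^ (seq_sum (Suc m) t - k) *
    (\<Sum>j\<in>{j \<in> {1..m} \<rightarrow>\<^sub>E UNIV. seq_sum m j = seq_sum (Suc m) t - k}. Gamma_prod q s (Suc m) r t j)"
proof -
  let ?T = "seq_sum (Suc m) t" and ?E = "S_V_exponent s (Suc m) r t"
  let ?H = "H_word free_U free_V (Suc m) r t"
  let ?N = "\<lambda>c. \<Sum>k = t 1..?T. free_scale (c k) (VU_monomial free_U free_V (?E k) k)"
  \<comment> \<open>The default 0 outside the range meets the first vanishing condition in
    \<open>S_coeff\<close>.\<close>
  define d where "d k = (if k \<in> {t 1..?T} then h ^ (?T - k) *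
    (\<Sum>j\<in>{j \<in> {1..m} \<rightarrow>\<^sub>E UNIV. seq_sum m j = ?T - k}. Gamma_prod q s (Suc m) r t j) else 0)" for k
  have neg: "d k = 0" if "?E k < 0" for k
  proof (cases "k \<in> {t 1..?T}")
    case True
    then have "(\<Sum>j\<in>{j \<in> {1..m} \<rightarrow>\<^sub>E UNIV. seq_sum m j = ?T - k}. Gamma_prod q s (Suc m) r t j) = 0"
      using that
      by (intro sum.neutral ballI Gamma_prod_eq_0_V_exponent) (auto simp: V_exponent_eq_S_V_exponent[where r = r])
    then show ?thesis by (simp add: d_def)
  next
    case False
    then show ?thesis unfolding d_def by (rule if_not_P)
  qed
  have N_d: "?N d = (\<Sum>k = t 1..?T. free_scale (h ^ (?T - k) *
      (\<Sum>j\<in>{j \<in> {1..m} \<rightarrow>\<^sub>E UNIV. seq_sum m j = ?T - k}. Gamma_prod q s (Suc m) r t j))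
      (VU_monomial free_U free_V (?E k) k))"
    by (intro sum.cong refl arg_cong2[of _ _ _ _ free_scale]) (unfold d_def, rule if_P)
  have H: "quot_eq s h q ?H (?N d)"
    using H_word_quot_eq[OF assms(1), of s h m r t]
    unfolding sum_box_by_degree[OF complex_algebra_free] N_d .
  have "S_coeff s h q (Suc m) r t = d"
    unfolding S_coeff_def
  proof (rule the_equality)
    show "(\<forall>k. k \<notin> {t 1..?T} \<longrightarrow> d k = 0) \<and> (\<forall>k. ?E k < 0 \<longrightarrow> d k = 0) \<and> quot_eq s h q ?H (?N d)"
      using neg H by (simp add: d_def)
  next
    fix c
    assume c: "(\<forall>k. k \<notin> {t 1..?T} \<longrightarrow> c k = 0) \<and> (\<forall>k. ?E k < 0 \<longrightarrow> c k = 0) \<and> quot_eq s h q ?H (?N c)"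
    then have eq: "quot_eq s h q (?N c) (?N d)"
      using quot_eq_trans[OF quot_eq_sym H] by blast
    show "c = d"
    proof
      fix k
      \<comment> \<open>Congruence determines the coefficients of the monomials not read as 0; the
        two vanishing conditions settle all other \<open>k\<close>.\<close>
      show "c k = d k"
      proof (cases "k \<in> {t 1..?T} \<and> ?E k \<ge> 0")
        case True
        then show ?thesis using normal_form_unique[OF assms(1) finite_atLeastAtMost eq] by blast
      next
        case False
        then have "k \<notin> {t 1..?T} \<or> ?E k < 0" by auto
        then have "c k = 0" using c by blast
        moreover have "d k = 0"
          using \<open>k \<notin> {t 1..?T} \<or> ?E k < 0\<close> neg unfolding d_def by (meson if_not_P)
        ultimately show ?thesis by simp
      qed
    qed
  qed
  with assms(2) show ?thesis by (simp add: d_def)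
qed

theorem theorem10:
  fixes s n :: nat and h q :: complex and r t :: "nat \<Rightarrow> nat"
    and scale :: "complex \<Rightarrow> 'a::ring_1 \<Rightarrow> 'a" and U V :: 'a
  assumes "h \<noteq> 0" and "q \<noteq> 0" and "n \<ge> 1"
    and "complex_algebra scale"
    and "U * V - scale q (V * U) = scale h (V ^ s)"
  shows "H_word U V n r t =
           (\<Sum>j \<in> (\<Pi>\<^sub>E i\<in>{1..n-1}. {0..t (i + 1)}).
              scale (h ^ seq_sum (n - 1) j * Gamma_prod q s n r t j)
                (VU_monomial U V (V_exponent s n r j) (seq_sum n t - seq_sum (n - 1) j)))
       \<and> quot_eq s h q (H_word free_U free_V n r t)
           (\<Sum>j \<in> (\<Pi>\<^sub>E i\<in>{1..n-1}. {0..t (i + 1)}).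
              free_scale (h ^ seq_sum (n - 1) j * Gamma_prod q s n r t j)
                (VU_monomial free_U free_V (V_exponent s n r j)
                  (seq_sum n t - seq_sum (n - 1) j)))
       \<and> (\<forall>j \<in> (\<Pi>\<^sub>E i\<in>{1..n-1}. {0..t (i + 1)}).
              V_exponent s n r j < 0 \<longrightarrow> Gamma_prod q s n r t j = 0)
       \<and> (\<forall>k \<in> {t 1..seq_sum n t}. S_coeff s h q n r t k =
              h ^ (seq_sum n t - k) *
              (\<Sum>j \<in> {j \<in> {1..n-1} \<rightarrow>\<^sub>E UNIV. seq_sum (n - 1) j = seq_sum n t - k}.
                 Gamma_prod q s n r t j))"
proof -
  obtain m where n: "n = Suc m" using assms(3) by (cases n) auto
  \<comment> \<open>The relation holds exactly, so the zero ideal suffices and congruence becomes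
    equality.\<close>
  have rel: "normal_ordering scale {0} U V s h q"
    using assms(2,4,5) by (intro normal_ordering.intro normal_ordering_axioms.intro) auto
  have "H_word U V (Suc m) r t =
      (\<Sum>j\<in>index_box m t. scale (h ^ seq_sum m j * Gamma_prod q s (Suc m) r t j)
        (VU_monomial U V (V_exponent s (Suc m) r j) (seq_sum (Suc m) t - seq_sum m j)))"
    using two_sided_ideal_singleton_0
      [OF normal_ordering.H_word_equiv[OF rel, unfolded normal_ordering.ideal_equiv_def[OF rel]]]
    by (simp only: right_minus_eq)
  moreover note H_word_quot_eq[OF assms(2), of s h m r t]
  moreover have "\<forall>j\<in>index_box m t. V_exponent s (Suc m) r j < 0 \<longrightarrow> Gamma_prod q s (Suc m) r t j = 0"
    by (simp add: Gamma_prod_eq_0_V_exponent)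
  moreover note ballI[OF S_coeff_eq[OF assms(2), of _ t m s h r]]
  ultimately show ?thesis
    unfolding n diff_Suc_1 index_box_def by (intro conjI)
qed

end
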